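(* Let $n\ge 2$ and let $*:(\mathcal{K}^n_s)^2\to\mathcal{K}^n$ be an operation. Then $*$ is continuous in the Hausdorff metric, $GL(n)$ covariant, and associative if and only if one of the following holds: (a) $K*L=\{o\}$ for all $K,L\in\mathcal{K}^n_s$; (b) $K*L=K$ for all $K,L\in\mathcal{K}^n_s$; (c) $K*L=L$ for all $K,L\in\mathcal{K}^n_s$; (d) there is a $p$ with $1\le p\le\infty$ such that $*$ is $L_p$ addition, i.e. $K*L=K+_pL$ for all $K,L\in\mathcal{K}^n_s$.
   Context: $\mathcal{K}^n$ is the class of nonempty compact convex subsets of $\mathbb{R}^n$; $\mathcal{K}^n_s$ is the subclass of $o$-symmetric sets ($K=-K$), where $o$ is the origin. The support function of $K\in\mathcal{K}^n$ is $h_K(x)=\sup\{x\cdot y:y\in K\}$, $x\in\mathbb{R}^n$. Properties of $*$ (for all $K,L,N,\dots\in\mathcal{K}^n_s$): continuous: $K_m\to K$ and $L_m\to L$ in the Hausdorff metric imply $K_m*L_m\to K*L$ in the Hausdorff metric; $GL(n)$ covariant: $\phi(K*L)=(\phi K)*(\phi L)$ for all $\phi\in GL(n)$; associative: $K*(L*N)=(K*L)*N$. (For a $GL(n)$ covariant $*$, taking $\phi=-\mathrm{id}$ shows $K*L\in\mathcal{K}^n_s$, so associativity is meaningful.) $L_p$ addition: for $1\le p<\infty$, $K+_pL$ is the compact convex set with $h_{K+_pL}(x)^p=h_K(x)^p+h_L(x)^p$ for all $x\in\mathbb{R}^n$; for $p=\infty$, $h_{K+_\infty L}(x)=\max\{h_K(x),h_L(x)\}$.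 *)

theory Defs
  imports "HOL-Analysis.Analysis"
begin

definition convex_bodies :: "'a::euclidean_space set set" where
  "convex_bodies = {K. K \<noteq> {} \<and> compact K \<and> convex K}"

definition sym_convex_bodies :: "'a::euclidean_space set set" where
  "sym_convex_bodies = {K \<in> convex_bodies. uminus ` K = K}"

definition support_fun :: "'a::euclidean_space set \<Rightarrow> 'a \<Rightarrow> real" where
  "support_fun K x = (SUP y\<in>K. x \<bullet> y)"

definition hausdorff_dist :: "'a::euclidean_space set \<Rightarrow> 'a set \<Rightarrow> real" where
  "hausdorff_dist K L = max (SUP x\<in>K. infdist x L) (SUP y\<in>L. infdist y K)"

definition hausdorff_tendsto :: "(nat \<Rightarrow> 'a::euclidean_space set) \<Rightarrow> 'a set \<Rightarrow> bool" where
  "hausdorff_tendsto X K \<longleftrightarrow> (\<lambda>m. hausdorff_dist (X m) K) \<longlonglongrightarrow> 0"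

text \<open>
  The operations below are meaningful only on pairs of \<open>o\<close>-symmetric sets; their values
  elsewhere are irrelevant, hence the relativised quantifiers.
\<close>

definition hausdorff_continuous_op ::
    "('a::euclidean_space set \<Rightarrow> 'a set \<Rightarrow> 'a set) \<Rightarrow> bool" where
  "hausdorff_continuous_op f \<longleftrightarrow>
     (\<forall>X Y K L. range X \<subseteq> sym_convex_bodies \<longrightarrow> range Y \<subseteq> sym_convex_bodies \<longrightarrow>
        K \<in> sym_convex_bodies \<longrightarrow> L \<in> sym_convex_bodies \<longrightarrow>
        hausdorff_tendsto X K \<longrightarrow> hausdorff_tendsto Y L \<longrightarrow>
        hausdorff_tendsto (\<lambda>m. f (X m) (Y m)) (f K L))"

definition GL_covariant_op ::
    "((real^'n) set \<Rightarrow> (real^'n) set \<Rightarrow> (real^'n) set) \<Rightarrow> bool" where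
  "GL_covariant_op f \<longleftrightarrow>
     (\<forall>A :: real^'n^'n. invertible A \<longrightarrow>
        (\<forall>K\<in>sym_convex_bodies. \<forall>L\<in>sym_convex_bodies.
           (*v) A ` f K L = f ((*v) A ` K) ((*v) A ` L)))"

definition associative_op ::
    "('a::euclidean_space set \<Rightarrow> 'a set \<Rightarrow> 'a set) \<Rightarrow> bool" where
  "associative_op f \<longleftrightarrow>
     (\<forall>K\<in>sym_convex_bodies. \<forall>L\<in>sym_convex_bodies. \<forall>N\<in>sym_convex_bodies.
        f K (f L N) = f (f K L) N)"

text \<open>
  For finite \<open>p\<close> the condition \<open>0 \<le> support_fun M x\<close> makes explicit that \<open>p\<close>-th powers are
  taken of nonnegative numbers. It is needed for uniqueness, since \<^const>\<open>powr\<close> on the reals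
  satisfies \<open>(- t) powr p = t powr p\<close>: without it, if \<open>K\<close> is a segment
  \<open>closed_segment (- e) e\<close> through the origin and \<open>L = {0}\<close>, then \<open>K\<close>, \<open>{e}\<close> and \<open>{- e}\<close> would all qualify.
\<close>

definition is_Lp_sum :: "ereal \<Rightarrow> 'a::euclidean_space set \<Rightarrow> 'a set \<Rightarrow> 'a set \<Rightarrow> bool" where
  "is_Lp_sum p K L M \<longleftrightarrow> M \<in> convex_bodies \<and>
     (if p = \<infinity>
      then \<forall>x. support_fun M x = max (support_fun K x) (support_fun L x)
      else \<forall>x. 0 \<le> support_fun M x \<and>
             support_fun M x powr real_of_ereal p =
               support_fun K x powr real_of_ereal p + support_fun L x powr real_of_ereal p)"

definition Lp_add :: "ereal \<Rightarrow> 'a::euclidean_space set \<Rightarrow> 'a set \<Rightarrow> 'a set" where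
  "Lp_add p K L = (THE M. is_Lp_sum p K L M)"

text \<open>
  The description in \<^const>\<open>Lp_add\<close> is proper: for \<open>o\<close>-symmetric arguments there is exactly one
  set satisfying \<^const>\<open>is_Lp_sum\<close>; and \<^const>\<open>hausdorff_dist\<close> has its usual meaning.
\<close>

lemma support_fun_bdd: "K \<in> convex_bodies \<Longrightarrow> bdd_above ((\<bullet>) x ` K)"
  by (auto simp: convex_bodies_def intro!: bounded_imp_bdd_above compact_imp_bounded
      compact_continuous_image continuous_intros)

lemma inner_le_support_fun: "K \<in> convex_bodies \<Longrightarrow> y \<in> K \<Longrightarrow> x \<bullet> y \<le> support_fun K x"
  unfolding support_fun_def by (rule cSUP_upper) (auto intro: support_fun_bdd)

lemma support_fun_le: "K \<in> convex_bodies \<Longrightarrow> (\<And>y. y \<in> K \<Longrightarrow> x \<bullet> y \<le> c) \<Longrightarrow> support_fun K x \<le> c"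
  unfolding support_fun_def by (rule cSUP_least) (auto simp: convex_bodies_def)

lemma convex_body_eq_support:
  fixes K :: "'a::euclidean_space set"
  assumes K: "K \<in> convex_bodies"
  shows "K = {y. \<forall>x. x \<bullet> y \<le> support_fun K x}"
proof (intro equalityI subsetI)
  fix y assume y: "y \<in> {y. \<forall>x. x \<bullet> y \<le> support_fun K x}"
  show "y \<in> K"
  proof (rule ccontr)
    assume "y \<notin> K"
    moreover have "convex K" "closed K" using K by (auto simp: convex_bodies_def compact_imp_closed)
    ultimately obtain a b where ab: "a \<bullet> y < b" "\<And>x. x \<in> K \<Longrightarrow> a \<bullet> x > b"
      using separating_hyperplane_closed_point[of K y] by auto
    have "support_fun K (-a) \<le> -b"
    proof (rule support_fun_le[OF K])
      fix z assume "z \<in> K"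
      then show "(-a) \<bullet> z \<le> -b" using ab(2)[of z] by simp
    qed
    moreover have "(-a) \<bullet> y \<le> support_fun K (-a)" using y by blast
    ultimately show False using ab(1) by simp
  qed
qed (auto intro: inner_le_support_fun[OF K])

lemma support_fun_inject:
  assumes "K \<in> convex_bodies" "L \<in> convex_bodies" "\<And>x. support_fun K x = support_fun L x"
  shows "K = L"
  using convex_body_eq_support[OF assms(1)] convex_body_eq_support[OF assms(2)] assms(3) by simp

lemma sublinear_imp_support_fun:
  fixes g :: "'a::euclidean_space \<Rightarrow> real"
  assumes sub: "\<And>x y. g (x + y) \<le> g x + g y" and hom: "\<And>c x. c > 0 \<Longrightarrow> g (c *\<^sub>R x) = c * g x"
    and g0: "g 0 = 0"
  obtains M where "M \<in> convex_bodies" "\<And>x. support_fun M x = g x"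
proof -
  define M where "M = {y. \<forall>x. x \<bullet> y \<le> g x}"
  have touch: "\<exists>y\<in>M. x0 \<bullet> y = g x0" for x0
  proof -
    let ?E = "{z. g (fst z) < snd z}"
    have cE: "convex ?E"
    proof (rule convexI)
      fix z w :: "'a \<times> real" and u v :: real
      assume z: "z \<in> ?E" and w: "w \<in> ?E" and uv: "u \<ge> 0" "v \<ge> 0" "u + v = 1"
      have hom': "g (c *\<^sub>R x) = c * g x" if "c \<ge> 0" for c x
        using hom[of c x] g0 that by (cases "c = 0") auto
      have "g (u *\<^sub>R fst z + v *\<^sub>R fst w) \<le> u * g (fst z) + v * g (fst w)"
        using sub[of "u *\<^sub>R fst z" "v *\<^sub>R fst w"] uv by (simp add: hom')
      also have "\<dots> < u * snd z + v * snd w"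
      proof (cases "u = 0")
        case True then show ?thesis using uv w by simp
      next
        case False
        then have "u * g (fst z) < u * snd z" using uv z by simp
        moreover have "v * g (fst w) \<le> v * snd w" using uv w by (simp add: mult_left_mono)
        ultimately show ?thesis by linarith
      qed
      finally show "u *\<^sub>R z + v *\<^sub>R w \<in> ?E" by simp
    qed
    have ne: "?E \<noteq> {}"
    proof -
      have "(0, 1) \<in> ?E" using g0 by simp
      then show ?thesis by blast
    qed
    obtain a b where ab: "a \<noteq> 0" "a \<bullet> (x0, g x0) \<le> b" "\<And>z. z \<in> ?E \<Longrightarrow> b \<le> a \<bullet> z"
      using separating_hyperplane_sets[of "{(x0, g x0)}" ?E] cE ne by auto
    obtain u s where a: "a = (u, s)" by (cases a)
    have E: "u \<bullet> x0 + s * g x0 \<le> u \<bullet> x + s * t" if "g x < t" for x t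
      using ab(2) ab(3)[of "(x,t)"] that by (auto simp: a)
    have s0: "s \<ge> 0"
    proof (rule ccontr)
      assume "\<not> s \<ge> 0"
      then have "s < 0" by simp
      have "s * g x0 \<le> s * (g x0 + 1)" using E[of x0 "g x0 + 1"] by simp
      then show False using \<open>s < 0\<close> by (simp add: algebra_simps)
    qed
    have "s \<noteq> 0"
    proof
      assume s: "s = 0"
      have "u \<bullet> x0 \<le> u \<bullet> (x0 - u)" using E[of "x0 - u" "g (x0 - u) + 1"] s by simp
      then have "u \<bullet> u \<le> 0" by (simp add: inner_diff_right)
      then have "u = 0" by (metis inner_gt_zero_iff not_less)
      then show False using ab(1) s a by (simp add: zero_prod_def)
    qed
    with s0 have s: "s > 0" by simp
    define y where "y = (- 1 / s) *\<^sub>R u"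
    have u: "u = - (s *\<^sub>R y)" using s by (simp add: y_def)
    have F: "g x0 - x0 \<bullet> y \<le> g x - x \<bullet> y" for x
    proof (rule field_le_epsilon)
      fix e :: real assume "e > 0"
      then have "s * (g x0 - x0 \<bullet> y) \<le> s * (g x - x \<bullet> y + e)"
        using E[of x "g x + e"] by (simp add: u algebra_simps inner_commute)
      then show "g x0 - x0 \<bullet> y \<le> g x - x \<bullet> y + e" using s by simp
    qed
    have 1: "g x0 - x0 \<bullet> y \<le> 0" using F[of 0] g0 by simp
    have 2: "g x0 - x0 \<bullet> y \<ge> 0" using F[of "2 *\<^sub>R x0"] by (simp add: hom)
    have "x \<bullet> y \<le> g x" for x using F[of x] 2 by linarith
    then have "y \<in> M" by (simp add: M_def)
    then show ?thesis using 1 2 by (intro bexI[of _ y]) auto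
  qed
  have M: "M = (\<Inter>x. {y. x \<bullet> y \<le> g x})" by (auto simp: M_def)
  have "bounded M"
  proof -
    have "norm y \<le> (\<Sum>b\<in>Basis. \<bar>g b\<bar> + \<bar>g (-b)\<bar>)" if "y \<in> M" for y
    proof -
      have "norm y \<le> (\<Sum>b\<in>Basis. \<bar>y \<bullet> b\<bar>)" by (rule norm_le_l1)
      also have "\<dots> \<le> (\<Sum>b\<in>Basis. \<bar>g b\<bar> + \<bar>g (-b)\<bar>)"
      proof (rule sum_mono)
        fix b :: 'a
        have "b \<bullet> y \<le> g b" "(-b) \<bullet> y \<le> g (-b)" using that unfolding M_def by blast+
        then show "\<bar>y \<bullet> b\<bar> \<le> \<bar>g b\<bar> + \<bar>g (-b)\<bar>" by (simp add: inner_commute)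
      qed
      finally show ?thesis .
    qed
    then show ?thesis unfolding bounded_iff by blast
  qed
  moreover have "closed M" "convex M" unfolding M
    by (auto intro!: closed_INT closed_halfspace_le convex_INT convex_halfspace_le)
  ultimately have MC: "M \<in> convex_bodies"
    using touch[of 0] by (auto simp: convex_bodies_def compact_eq_bounded_closed)
  have "support_fun M x = g x" for x
  proof (rule antisym)
    show "support_fun M x \<le> g x" by (rule support_fun_le[OF MC]) (auto simp: M_def)
    show "g x \<le> support_fun M x" using touch[of x] inner_le_support_fun[OF MC] by metis
  qed
  with MC show ?thesis by (rule that)
qed

lemma powr_convex_nonneg:
  fixes x y l p :: real
  assumes "p \<ge> 1" "x \<ge> 0" "y \<ge> 0" "0 < l" "l < 1"
  shows "((1 - l) * x + l * y) powr p \<le> (1 - l) * x powr p + l * y powr p"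
proof -
  have sm: "(c * t) powr p \<le> c * t powr p" if "0 < c" "c < 1" "t \<ge> 0" for c t
  proof -
    have "c powr p \<le> c powr 1" using that assms(1) by (intro powr_mono') auto
    then show ?thesis using that by (simp add: powr_mult mult_right_mono)
  qed
  consider "x = 0" | "y = 0" | "x > 0" "y > 0" using assms by linarith
  then show ?thesis
  proof cases
    case 1 then show ?thesis using sm[of l y] assms by simp
  next
    case 2 then show ?thesis using sm[of "1 - l" x] assms by simp
  next
    case 3
    then show ?thesis using convex_onD[OF powr_convex[OF assms(1)], of l x y] assms by simp
  qed
qed

lemma minkowski2:
  fixes a b c d p :: real
  assumes p: "p \<ge> 1" and nn: "a \<ge> 0" "b \<ge> 0" "c \<ge> 0" "d \<ge> 0"
  shows "((a + c) powr p + (b + d) powr p) powr (1/p)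
         \<le> (a powr p + b powr p) powr (1/p) + (c powr p + d powr p) powr (1/p)"
proof -
  define s where "s = (a powr p + b powr p) powr (1/p)"
  define t where "t = (c powr p + d powr p) powr (1/p)"
  have sp: "s powr p = a powr p + b powr p" "t powr p = c powr p + d powr p"
    using p by (auto simp: s_def t_def powr_powr)
  have st0: "s \<ge> 0" "t \<ge> 0" by (auto simp: s_def t_def)
  consider "s = 0" | "t = 0" | "s > 0" "t > 0" using st0 by linarith
  then have "((a + c) powr p + (b + d) powr p) powr (1/p) \<le> s + t"
  proof cases
    case 1
    then have "a powr p + b powr p = 0" using sp p by simp
    then have "a = 0" "b = 0" by (auto simp: add_nonneg_eq_0_iff)
    then show ?thesis using 1 by (simp add: t_def)
  next
    case 2
    then have "c powr p + d powr p = 0" using sp p by simp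
    then have "c = 0" "d = 0" by (auto simp: add_nonneg_eq_0_iff)
    then show ?thesis using 2 by (simp add: s_def)
  next
    case 3
    define l where "l = t / (s + t)"
    have l: "0 < l" "l < 1" "1 - l = s / (s + t)" using 3 by (auto simp: l_def field_simps)
    have 4: "(u + v) powr p \<le> (s + t) powr p * ((1 - l) * (u powr p / s powr p) + l * (v powr p / t powr p))"
      if "u \<ge> 0" "v \<ge> 0" for u v
    proof -
      have "(1 - l) * (u / s) + l * (v / t) = (u + v) / (s + t)"
        using 3 l(3) by (simp add: l_def add_divide_distrib)
      then have "((u + v) / (s + t)) powr p \<le> (1 - l) * (u / s) powr p + l * (v / t) powr p"
        using powr_convex_nonneg[OF p, of "u/s" "v/t" l] that 3 l by simp
      then have "(s + t) powr p * ((u + v) / (s + t)) powr p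
         \<le> (s + t) powr p * ((1 - l) * (u / s) powr p + l * (v / t) powr p)"
        by (rule mult_left_mono) simp
      moreover have "(s + t) powr p * ((u + v) / (s + t)) powr p = (u + v) powr p"
        using 3 that by (simp add: powr_divide)
      ultimately show ?thesis using 3 that by (simp add: powr_divide)
    qed
    have "(a + c) powr p + (b + d) powr p \<le> (s + t) powr p *
        ((1 - l) * ((a powr p + b powr p) / s powr p) + l * ((c powr p + d powr p) / t powr p))"
      using 4[of a c] 4[of b d] nn by (simp add: algebra_simps add_divide_distrib)
    also have "\<dots> = (s + t) powr p" using 3 by (simp flip: sp)
    finally have "((a + c) powr p + (b + d) powr p) powr (1/p) \<le> ((s + t) powr p) powr (1/p)"
      using p by (intro powr_mono2) auto
    also have "\<dots> = s + t" using p 3 by (simp add: powr_powr)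
    finally show ?thesis .
  qed
  then show ?thesis by (simp add: s_def t_def)
qed

lemma support_fun_add_le:
  assumes K: "K \<in> convex_bodies"
  shows "support_fun K (x + y) \<le> support_fun K x + support_fun K y"
  by (rule support_fun_le[OF K])
    (auto simp: inner_add_left intro!: add_mono inner_le_support_fun[OF K])

lemma support_fun_scaleR:
  assumes K: "K \<in> convex_bodies" and c: "c > 0"
  shows "support_fun K (c *\<^sub>R x) = c * support_fun K x"
proof -
  have le: "support_fun K (d *\<^sub>R z) \<le> d * support_fun K z" if "d > 0" for d z
    using that by (intro support_fun_le[OF K]) (auto intro!: mult_left_mono inner_le_support_fun[OF K])
  show ?thesis
    using le[OF c, of x] le[of "1/c" "c *\<^sub>R x"] c by (simp add: field_simps)
qed

lemma support_fun_zero: "K \<in> convex_bodies \<Longrightarrow> support_fun K 0 = 0"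
  by (auto simp: support_fun_def convex_bodies_def)

lemma sym_zero_in: assumes "K \<in> sym_convex_bodies" shows "0 \<in> K"
proof -
  have K: "K \<noteq> {}" "convex K" "uminus ` K = K" using assms by (auto simp: sym_convex_bodies_def convex_bodies_def)
  then obtain x where "x \<in> K" by blast
  moreover have "- x \<in> K" using K(3) calculation by blast
  ultimately have "(1/2) *\<^sub>R x + (1/2) *\<^sub>R (- x) \<in> K" using K(2) by (intro convexD) auto
  then show ?thesis by simp
qed

lemma sym_support_nonneg: "K \<in> sym_convex_bodies \<Longrightarrow> 0 \<le> support_fun K x"
  using inner_le_support_fun[of K 0 x] sym_zero_in[of K] by (auto simp: sym_convex_bodies_def)

lemma Lp_sum_unique:
  assumes "1 \<le> p" "is_Lp_sum p K L M" "is_Lp_sum p K L M'"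
  shows "M = M'"
proof (rule support_fun_inject)
  show "M \<in> convex_bodies" "M' \<in> convex_bodies" using assms by (auto simp: is_Lp_sum_def)
  fix x
  show "support_fun M x = support_fun M' x"
  proof (cases "p = \<infinity>")
    case True then show ?thesis using assms by (simp add: is_Lp_sum_def)
  next
    case False
    then have q: "real_of_ereal p \<ge> 1" using assms(1) by (cases p) auto
    have e: "support_fun M x powr real_of_ereal p = support_fun M' x powr real_of_ereal p"
       "0 \<le> support_fun M x" "0 \<le> support_fun M' x"
      using assms False by (auto simp: is_Lp_sum_def)
    then have "(support_fun M x powr real_of_ereal p) powr (1 / real_of_ereal p)
       = (support_fun M' x powr real_of_ereal p) powr (1 / real_of_ereal p)" by simp
    then show ?thesis using e(2,3) q unfolding powr_powr by simp
  qed
qed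

lemma Lp_sum_exists:
  assumes p: "1 \<le> p" and K: "K \<in> sym_convex_bodies" and L: "L \<in> sym_convex_bodies"
  shows "\<exists>M. is_Lp_sum p K L M"
proof -
  have KC: "K \<in> convex_bodies" and LC: "L \<in> convex_bodies" using K L by (auto simp: sym_convex_bodies_def)
  note nn = sym_support_nonneg[OF K] sym_support_nonneg[OF L]
  note sub = support_fun_add_le[OF KC] support_fun_add_le[OF LC]
  note hom = support_fun_scaleR[OF KC] support_fun_scaleR[OF LC]
  show ?thesis
  proof (cases "p = \<infinity>")
    case True
    obtain M where "M \<in> convex_bodies" "\<And>x. support_fun M x = max (support_fun K x) (support_fun L x)"
    proof (rule sublinear_imp_support_fun[of "\<lambda>x. max (support_fun K x) (support_fun L x)"])
      fix x y
      show "max (support_fun K (x + y)) (support_fun L (x + y))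
         \<le> max (support_fun K x) (support_fun L x) + max (support_fun K y) (support_fun L y)"
        using sub[of x y] by linarith
    qed (auto simp: hom support_fun_zero[OF KC] support_fun_zero[OF LC] max_mult_distrib_left)
    then show ?thesis using True by (auto simp: is_Lp_sum_def)
  next
    case False
    define q where "q = real_of_ereal p"
    have q: "q \<ge> 1" using p False by (cases p) (auto simp: q_def)
    define g where "g = (\<lambda>x. (support_fun K x powr q + support_fun L x powr q) powr (1/q))"
    obtain M where "M \<in> convex_bodies" "\<And>x. support_fun M x = g x"
    proof (rule sublinear_imp_support_fun[of g])
      fix x y
      have "g (x + y) \<le> ((support_fun K x + support_fun K y) powr q + (support_fun L x + support_fun L y) powr q) powr (1/q)"
        unfolding g_def using q nn sub by (intro powr_mono2 add_mono) auto
      also have "\<dots> \<le> g x + g y" unfolding g_def using q nn by (intro minkowski2) auto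
      finally show "g (x + y) \<le> g x + g y" .
    next
      fix c :: real and x assume c: "c > 0"
      have "g (c *\<^sub>R x) = (c powr q * (support_fun K x powr q + support_fun L x powr q)) powr (1/q)"
        using c nn by (simp add: g_def hom powr_mult algebra_simps)
      also have "\<dots> = c * g x" using c q by (simp add: g_def powr_mult powr_powr)
      finally show "g (c *\<^sub>R x) = c * g x" .
    qed (auto simp: g_def support_fun_zero[OF KC] support_fun_zero[OF LC])
    moreover have "g x \<ge> 0" "g x powr q = support_fun K x powr q + support_fun L x powr q" for x
      using q by (auto simp: g_def powr_powr)
    ultimately show ?thesis using False by (auto simp: is_Lp_sum_def q_def)
  qed
qed

lemma is_Lp_sum_Lp_add:
  assumes "1 \<le> p" "K \<in> sym_convex_bodies" "L \<in> sym_convex_bodies"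
  shows "is_Lp_sum p K L (Lp_add p K L)"
  unfolding Lp_add_def
  by (rule theI') (use Lp_sum_exists[OF assms] Lp_sum_unique[OF assms(1)] in blast)

lemma hausdorff_dist_le_iff:
  assumes K: "K \<in> convex_bodies" and L: "L \<in> convex_bodies"
  shows "hausdorff_dist K L \<le> r \<longleftrightarrow> (\<forall>x\<in>K. \<exists>y\<in>L. dist x y \<le> r) \<and> (\<forall>y\<in>L. \<exists>x\<in>K. dist y x \<le> r)"
proof -
  have aux: "(SUP x\<in>A. infdist x B) \<le> r \<longleftrightarrow> (\<forall>x\<in>A. \<exists>y\<in>B. dist x y \<le> r)"
    if "A \<in> convex_bodies" "B \<in> convex_bodies" for A B :: "'a set"
  proof -
    have AB: "A \<noteq> {}" "compact A" "B \<noteq> {}" "compact B" using that by (auto simp: convex_bodies_def)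
    have "bdd_above ((\<lambda>x. infdist x B) ` A)"
      using AB by (intro bounded_imp_bdd_above compact_imp_bounded compact_continuous_image continuous_intros) auto
    then have "(SUP x\<in>A. infdist x B) \<le> r \<longleftrightarrow> (\<forall>x\<in>A. infdist x B \<le> r)"
      using AB by (simp add: cSUP_le_iff)
    also have "\<dots> \<longleftrightarrow> (\<forall>x\<in>A. \<exists>y\<in>B. dist x y \<le> r)"
      using AB infdist_attains_inf[of B] infdist_le order_trans compact_imp_closed by metis
    finally show ?thesis .
  qed
  show ?thesis unfolding hausdorff_dist_def using aux[OF K L] aux[OF L K] by simp
qed

end

theory Submission
  imports Defs
begin

text \<open>
  By continuity, covariance under invertible maps extends to the rank one maps
  \<open>y \<mapsto> (x \<bullet> y) e\<close>, which send a symmetric body \<open>K\<close> to the segment with end points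
  \<open>\<plusminus> h\<^sub>K(x) e\<close>. Hence \<open>h(K * L, x) = F (h\<^sub>K x) (h\<^sub>L x)\<close> for one function \<open>F\<close> on the
  quadrant, which is homogeneous, associative and, by taking two orthogonal segments for \<open>K\<close> and
  \<open>L\<close>, induces a seminorm \<open>F \<bar>a\<bar> \<bar>b\<bar>\<close> on the plane. By associativity \<open>F 1 0\<close> and \<open>F 0 1\<close>
  are idempotent, so each is \<open>0\<close> or \<open>1\<close>; three of the four cases are trivial. If both are \<open>1\<close>, the
  iterates \<open>F (\<dots> F (F 1 1) 1 \<dots>) 1\<close> form a monotone and completely multiplicative sequence,
  hence a power \<open>n powr (1 / p)\<close>, and homogeneity and continuity determine \<open>F\<close>;
  exponent \<open>0\<close> gives the maximum.
\<close>

section \<open>Monotone completely multiplicative sequences\<close>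

text \<open>On a logarithmic scale \<open>n ^ k\<close> lies within one step of a power of 2.
  Monotonicity and multiplicativity carry this over to \<open>a\<close>, so
  \<open>log 2 (a n)\<close> differs from its predicted value by at most \<open>s / k\<close>, for
  every positive \<open>k\<close>.\<close>

lemma monotone_multiplicative_eq_powr:
  fixes a :: "nat \<Rightarrow> real"
  assumes mult: "\<And>m n. m > 0 \<Longrightarrow> n > 0 \<Longrightarrow> a (m * n) = a m * a n"
    and mono: "\<And>m n. 0 < m \<Longrightarrow> m \<le> n \<Longrightarrow> a m \<le> a n"
    and one: "a 1 = 1" and n: "n > 0"
  shows "a n = real n powr log 2 (a 2)"
proof -
  define s where "s = log 2 (a 2)"
  define t where "t = log 2 (a n)"
  have ge1: "a m \<ge> 1" if "m > 0" for m using mono[of 1 m] that one by simp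
  have pow: "a (m ^ k) = a m ^ k" if "m > 0" for m k
    using that one by (induction k) (auto simp: mult)
  have logpow: "log 2 (a (m ^ k)) = k * log 2 (a m)" if "m > 0" for m k
    using ge1[OF that] that by (simp add: pow log_nat_power)
  have s0: "s \<ge> 0" using ge1[of 2] by (simp add: s_def)
  text \<open>Both \<open>k * t\<close> and \<open>k * s * log 2 n\<close> lie in \<open>[j * s, (j + 1) * s]\<close>, where
    \<open>2 ^ j \<le> n ^ k < 2 ^ (j + 1)\<close>.\<close>
  have bound: "real k * \<bar>t - s * log 2 n\<bar> \<le> s" if k: "k > 0" for k :: nat
  proof -
    obtain j where j: "2 ^ j \<le> n ^ k" "n ^ k < 2 ^ (j + 1)"
      using ex_power_ivl1[of 2 "n ^ k"] n by (auto simp: Suc_le_eq)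
    have lg: "log 2 (a u) \<le> log 2 (a v)" if "u > 0" "u \<le> v" for u v
      using mono[OF that] ge1[of u] ge1[of v] that by simp
    have 1: "j * s \<le> k * t" "k * t \<le> (j + 1) * s"
      using lg[of "2 ^ j" "n ^ k"] lg[of "n ^ k" "2 ^ (j + 1)"] j n logpow[of 2 j] logpow[of 2 "j + 1"] logpow[of n k]
      by (auto simp: s_def t_def)
    have "real (2 ^ j) \<le> real (n ^ k)" "real (n ^ k) \<le> real (2 ^ (j + 1))"
      using j by (simp_all only: of_nat_le_iff less_imp_le)
    then have "log 2 (2 ^ j) \<le> log 2 (real n ^ k)" "log 2 (real n ^ k) \<le> log 2 (2 ^ (j + 1))"
      using n by (subst log_le_cancel_iff; simp)+
    then have "j \<le> k * log 2 n" "k * log 2 n \<le> j + 1"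
      using n log_nat_power[of 2 2 j] log_nat_power[of 2 2 "j + 1"] log_nat_power[of "real n" 2 k] by simp_all
    then have 2: "j * s \<le> k * log 2 n * s" "k * log 2 n * s \<le> (j + 1) * s"
      using s0 by (intro mult_right_mono; simp)+
    show ?thesis
      using 1 2 k by (simp add: abs_if algebra_simps)
  qed
  have "t = s * log 2 n"
  proof (rule ccontr)
    assume "t \<noteq> s * log 2 n"
    then obtain k where "s < real k * \<bar>t - s * log 2 n\<bar>"
      using reals_Archimedean3[of "\<bar>t - s * log 2 n\<bar>"] by auto
    then show False using bound[of k] s0 by (cases k) auto
  qed
  then have "2 powr t = (2 powr log 2 n) powr s" by (simp add: powr_powr mult.commute)
  then show ?thesis using ge1[OF n] n by (simp add: t_def s_def)
qed

section \<open>Associative seminorms on the quadrant\<close>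

text \<open>The absolute values let \<open>triangle\<close> speak about the whole plane while
  \<open>F\<close> is used on the quadrant only. Continuity comes out of \<open>triangle\<close>, in
  the form of \<open>lipschitz_left\<close>.\<close>

locale seminorm_semigroup =
  fixes F :: "real \<Rightarrow> real \<Rightarrow> real"
  assumes nonneg: "a \<ge> 0 \<Longrightarrow> b \<ge> 0 \<Longrightarrow> F a b \<ge> 0"
    and hom: "c \<ge> 0 \<Longrightarrow> a \<ge> 0 \<Longrightarrow> b \<ge> 0 \<Longrightarrow> F (c * a) (c * b) = c * F a b"
    and triangle: "F \<bar>a + a'\<bar> \<bar>b + b'\<bar> \<le> F \<bar>a\<bar> \<bar>b\<bar> + F \<bar>a'\<bar> \<bar>b'\<bar>"
    and assoc: "a \<ge> 0 \<Longrightarrow> b \<ge> 0 \<Longrightarrow> c \<ge> 0 \<Longrightarrow> F a (F b c) = F (F a b) c"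
begin

text \<open>A convex function that is even in each variable increases in each variable on the quadrant:
  \<open>(a, b)\<close> lies on the segment between \<open>(\<plusminus>a', b)\<close>.\<close>

lemma mono_left:
  assumes "0 \<le> a" "a \<le> a'" "0 \<le> b" shows "F a b \<le> F a' b"
proof (cases "a' = 0")
  case False
  define l where "l = (a' + a) / (2 * a')"
  define m where "m = (a' - a) / (2 * a')"
  have lm: "0 \<le> l" "0 \<le> m" "l + m = 1" "l * a' - m * a' = a"
    using assms False by (auto simp: l_def m_def field_simps)
  have "F \<bar>l * a' + - (m * a')\<bar> \<bar>l * b + m * b\<bar> \<le> F \<bar>l * a'\<bar> \<bar>l * b\<bar> + F \<bar>- (m * a')\<bar> \<bar>m * b\<bar>"
    by (rule triangle)
  also have "\<dots> = l * F a' b + m * F a' b"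
    using lm assms by (simp add: abs_mult hom)
  also have "\<dots> = F a' b" using lm by (simp flip: distrib_right)
  finally show ?thesis using lm assms by (simp flip: distrib_right)
qed (use assms in simp)

lemma mono_right:
  assumes "0 \<le> a" "0 \<le> b" "b \<le> b'" shows "F a b \<le> F a b'"
proof (cases "b' = 0")
  case False
  define l where "l = (b' + b) / (2 * b')"
  define m where "m = (b' - b) / (2 * b')"
  have lm: "0 \<le> l" "0 \<le> m" "l + m = 1" "l * b' - m * b' = b"
    using assms False by (auto simp: l_def m_def field_simps)
  have "F \<bar>l * a + m * a\<bar> \<bar>l * b' + - (m * b')\<bar> \<le> F \<bar>l * a\<bar> \<bar>l * b'\<bar> + F \<bar>m * a\<bar> \<bar>- (m * b')\<bar>"
    by (rule triangle)
  also have "\<dots> = l * F a b' + m * F a b'"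
    using lm assms by (simp add: abs_mult hom)
  also have "\<dots> = F a b'" using lm by (simp flip: distrib_right)
  finally show ?thesis using lm assms by (simp flip: distrib_right)
qed (use assms in simp)

lemma zero: "F 0 0 = 0"
  using hom[of 0 0 0] by simp

lemma left_axis: "a \<ge> 0 \<Longrightarrow> F a 0 = a * F 1 0"
  using hom[of a 1 0] by simp

lemma right_axis: "b \<ge> 0 \<Longrightarrow> F 0 b = b * F 0 1"
  using hom[of b 0 1] by simp

text \<open>Put \<open>t = F 1 0\<close>. Associativity at \<open>(1, 0, 0)\<close> reads
  \<open>t = t * t\<close>, because \<open>F 0 0 = 0\<close> on one side and
  \<open>F t 0 = t * t\<close> on the other.\<close>

lemma left_axis_cases: "F 1 0 = 0 \<or> F 1 0 = 1"
  using assoc[of 1 0 0] left_axis[of "F 1 0"] nonneg[of 1 0] by (auto simp: zero)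

lemma right_axis_cases: "F 0 1 = 0 \<or> F 0 1 = 1"
  using assoc[of 0 0 1] right_axis[of "F 0 1"] nonneg[of 0 1] by (auto simp: zero)

lemma le_axes: "a \<ge> 0 \<Longrightarrow> b \<ge> 0 \<Longrightarrow> F a b \<le> a * F 1 0 + b * F 0 1"
  using triangle[of a 0 0 b] left_axis[of a] right_axis[of b] by simp

text \<open>Bracket \<open>a, 0, b\<close> in both ways: one side collapses through
  \<open>F 0 b = 0\<close> to \<open>F a 0 = a\<close>, the other through \<open>F a 0 = a\<close>
  to \<open>F a b\<close>.\<close>

lemma left_projection:
  assumes "F 1 0 = 1" "F 0 1 = 0" "a \<ge> 0" "b \<ge> 0" shows "F a b = a"
  using assoc[of a 0 b] left_axis[of a] right_axis[of b] assms by simp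

lemma right_projection:
  assumes "F 1 0 = 0" "F 0 1 = 1" "a \<ge> 0" "b \<ge> 0" shows "F a b = b"
  using assoc[of a 0 b] left_axis[of a] right_axis[of b] assms by simp

text \<open>The difference of \<open>(a, b)\<close> and \<open>(a', b)\<close> lies on the first
  axis, where the seminorm is the absolute value.\<close>

lemma lipschitz_left:
  assumes "F 1 0 = 1" "a \<ge> 0" "a' \<ge> 0" "b \<ge> 0"
  shows "\<bar>F a b - F a' b\<bar> \<le> \<bar>a - a'\<bar>"
  using triangle[of a' "a - a'" b 0] triangle[of a "a' - a" b 0] left_axis[of "\<bar>a - a'\<bar>"] assms
  by (simp add: abs_minus_commute)

section \<open>Unit axis values: maximum or power sum\<close>

context
  assumes axes: "F 1 0 = 1" "F 0 1 = 1"
begin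

text \<open>The \<open>n\<close>-fold sum of \<open>1\<close> with respect to \<open>F\<close>.
  Starting at \<open>0\<close> gives \<open>multiple 1 = F 0 1 = 1\<close>; for \<open>L_p\<close>
  addition the values are \<open>n powr (1 / p)\<close> when \<open>n > 0\<close>.\<close>

fun multiple :: "nat \<Rightarrow> real" where
  "multiple 0 = 0"
| "multiple (Suc n) = F (multiple n) 1"

lemma multiple_nonneg: "multiple n \<ge> 0"
  by (induction n) (auto intro: nonneg)

lemma multiple_1: "multiple 1 = 1" "multiple (Suc 0) = 1"
  using axes by simp_all

lemma F_multiple: "F (multiple m) (multiple n) = multiple (m + n)"
proof (induction n)
  case 0 then show ?case using left_axis[of "multiple m"] axes by (simp add: multiple_nonneg)
next
  case (Suc n) then show ?case by (simp add: assoc multiple_nonneg)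
qed

text \<open>Homogeneity acts as a distributive law: the summand \<open>multiple n\<close> is
  \<open>multiple n\<close> times the summand \<open>1\<close>, so the common factor can be pulled
  out of \<open>F\<close>.\<close>

lemma multiple_mult: "multiple (m * n) = multiple m * multiple n"
proof (induction m)
  case (Suc m)
  have "multiple (Suc m * n) = F (multiple (m * n)) (multiple n)"
    by (simp add: F_multiple add.commute)
  also have "\<dots> = multiple n * F (multiple m) 1"
    using Suc hom[of "multiple n" "multiple m" 1] by (simp add: multiple_nonneg mult.commute)
  finally show ?case by simp
qed simp

lemma multiple_mono: "m \<le> n \<Longrightarrow> multiple m \<le> multiple n"
proof (rule lift_Suc_mono_le)
  fix k
  have "multiple k = F (multiple k) 0" using left_axis[of "multiple k"] axes by (simp add: multiple_nonneg)
  also have "\<dots> \<le> F (multiple k) 1" by (intro mono_right multiple_nonneg) auto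
  finally show "multiple k \<le> multiple (Suc k)" by simp
qed

lemma multiple_eq: "n > 0 \<Longrightarrow> multiple n = real n powr log 2 (F 1 1)"
  using monotone_multiplicative_eq_powr[of multiple n] multiple_mult multiple_mono multiple_1
  by (simp add: numeral_2_eq_2)

text \<open>These bounds put the exponent \<open>log 2 (F 1 1)\<close>, which plays the role of
  \<open>1 / p\<close>, into the interval from 0 to 1.\<close>

lemma F_11: "1 \<le> F 1 1" "F 1 1 \<le> 2"
  using mono_right[of 1 0 1] le_axes[of 1 1] axes by auto

text \<open>Monotonicity allows both arguments to be raised to the maximum, where homogeneity
  applies, and either argument to be lowered to \<open>0\<close>, where the axis values
  apply.\<close>

lemma eq_max:
  assumes "F 1 1 = 1" "a \<ge> 0" "b \<ge> 0" shows "F a b = max a b"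
proof (rule antisym)
  have "F a b \<le> F (max a b) b" using assms by (intro mono_left) auto
  also have "\<dots> \<le> F (max a b) (max a b)" using assms by (intro mono_right) auto
  also have "\<dots> = max a b" using hom[of "max a b" 1 1] assms by simp
  finally show "F a b \<le> max a b" .
  have "a \<le> F a b" using mono_right[of a 0 b] left_axis[of a] axes assms by simp
  moreover have "b \<le> F a b" using mono_left[of 0 a b] right_axis[of b] axes assms by simp
  ultimately show "max a b \<le> F a b" by simp
qed

text \<open>Since \<open>F 1 1\<close> is not \<open>1\<close>, the exponent \<open>s\<close> is
  positive and \<open>p = 1 / s\<close> is finite. In the variable \<open>x powr s\<close> the claim
  becomes \<open>F (x powr s) 1 = (x + 1) powr s\<close>; it passes from integer pairs to rational
  \<open>x\<close> by homogeneity and to real \<open>x\<close> by continuity.\<close>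

lemma eq_powr:
  assumes "F 1 1 \<noteq> 1"
  obtains p where "p \<ge> 1" "\<And>a b. a \<ge> 0 \<Longrightarrow> b \<ge> 0 \<Longrightarrow> F a b = (a powr p + b powr p) powr (1 / p)"
proof
  define s where "s = log 2 (F 1 1)"
  have s: "0 < s" "s \<le> 1" using assms F_11 by (auto simp: s_def)
  define p where "p = 1 / s"
  show p: "p \<ge> 1" using s by (simp add: p_def)
  have int: "F (real m powr s) (real n powr s) = real (m + n) powr s" if "m > 0" "n > 0" for m n
    using F_multiple[of m n] that by (simp add: multiple_eq s_def)
  have rat: "F (q powr s) 1 = (q + 1) powr s" if q: "q \<in> \<rat>" "q > 0" for q
  proof -
    obtain m n :: nat where mn: "n \<noteq> 0" "\<bar>q\<bar> = m / n" using Rats_abs_nat_div_natE[OF q(1)] by metis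
    then have "m > 0" using q by (cases m) auto
    \<comment> \<open>Clearing the denominator: both arguments share the factor
      \<open>(1 / n) powr s\<close>, which leaves the integer pair \<open>m, n\<close>.\<close>
    have "F (q powr s) 1 = F ((1 / n) powr s * m powr s) ((1 / n) powr s * n powr s)"
      using mn q by (simp flip: powr_mult)
    also have "\<dots> = (1 / n) powr s * (real (m + n) powr s)"
      using mn \<open>m > 0\<close> by (simp add: hom int)
    also have "\<dots> = (q + 1) powr s" using mn q by (simp flip: powr_mult) (simp add: field_simps)
    finally show ?thesis .
  qed
  have real: "F (x powr s) 1 = (x + 1) powr s" if x: "x > 0" for x
  proof -
    have "\<exists>q. q \<in> \<rat> \<and> q > 0 \<and> \<bar>q - x\<bar> < 1 / Suc n" for n
    proof -
      \<comment> \<open>Approximating from above keeps the rationals positive, as \<open>rat\<close>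
        demands.\<close>
      obtain q where "q \<in> \<rat>" "x < q" "q < x + 1 / Suc n" using Rats_dense_in_real[of x "x + 1 / Suc n"] by auto
      then show ?thesis using x by (intro exI[of _ q]) auto
    qed
    then obtain q where q: "\<And>n. q n \<in> \<rat>" "\<And>n. q n > 0" "\<And>n. \<bar>q n - x\<bar> < 1 / Suc n" by metis
    have lim: "q \<longlonglongrightarrow> x"
      by (rule LIMSEQ_norm_0[of "\<lambda>n. q n - x", THEN LIM_zero_cancel])
        (use q(3) in \<open>auto simp: inverse_eq_divide\<close>)
    have "(\<lambda>n. F (q n powr s) 1 - F (x powr s) 1) \<longlonglongrightarrow> 0"
    proof (rule Lim_null_comparison)
      show "\<forall>\<^sub>F n in sequentially. norm (F (q n powr s) 1 - F (x powr s) 1) \<le> \<bar>q n powr s - x powr s\<bar>"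
        using lipschitz_left axes by simp
      have "(\<lambda>n. q n powr s - x powr s) \<longlonglongrightarrow> x powr s - x powr s"
        using lim x by (intro tendsto_intros) auto
      then show "(\<lambda>n. \<bar>q n powr s - x powr s\<bar>) \<longlonglongrightarrow> 0" using tendsto_rabs_zero by fastforce
    qed
    then have "(\<lambda>n. F (q n powr s) 1) \<longlonglongrightarrow> F (x powr s) 1" by (rule LIM_zero_cancel)
    moreover have "(\<lambda>n. (q n + 1) powr s) \<longlonglongrightarrow> (x + 1) powr s" using lim x by (intro tendsto_intros) auto
    ultimately show ?thesis using LIMSEQ_unique by (simp add: rat q)
  qed
  fix a b :: real assume ab: "a \<ge> 0" "b \<ge> 0"
  have ps: "1 / p = s" by (simp add: p_def)
  have pinv: "(c powr p) powr s = c" if "c \<ge> 0" for c using that s by (simp add: powr_powr p_def)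
  \<comment> \<open>The scaling by \<open>b\<close> and the formula \<open>real\<close> need
    positive numbers; the axes are settled by the axis values.\<close>
  consider "a = 0" | "b = 0" | "a > 0" "b > 0" using ab by linarith
  then show "F a b = (a powr p + b powr p) powr (1 / p)"
  proof cases
    case 1 then show ?thesis using right_axis[of b] ab axes pinv by (simp add: ps)
  next
    case 2 then show ?thesis using left_axis[of a] ab axes pinv by (simp add: ps)
  next
    case 3
    \<comment> \<open>Scale the second argument to \<open>1\<close> and write the ratio as
      \<open>x powr s\<close> with \<open>x = (a / b) powr p\<close>.\<close>
    have "F a b = b * F (((a / b) powr p) powr s) 1" using hom[of b "a / b" 1] 3 pinv[of "a / b"] by simp
    also have "\<dots> = (b powr p) powr s * ((a / b) powr p + 1) powr s" using 3 pinv[of b] by (simp add: real)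
    also have "\<dots> = (b powr p * ((a / b) powr p + 1)) powr s" using 3 by (simp add: powr_mult)
    also have "b powr p * ((a / b) powr p + 1) = a powr p + b powr p"
      using 3 by (simp add: powr_divide field_simps)
    finally show ?thesis by (simp add: ps)
  qed
qed

end

end

section \<open>Hausdorff distance in terms of support functions\<close>

lemma support_diff_le_of_near:
  assumes K: "K \<in> convex_bodies" and L: "L \<in> convex_bodies"
    and near: "\<forall>x\<in>K. \<exists>y\<in>L. dist x y \<le> r"
  shows "support_fun K x - support_fun L x \<le> r * norm x"
proof -
  have "support_fun K x \<le> support_fun L x + r * norm x"
  proof (rule support_fun_le[OF K])
    fix y assume "y \<in> K"
    then obtain z where z: "z \<in> L" "dist y z \<le> r" using near by blast
    have "x \<bullet> y = x \<bullet> z + x \<bullet> (y - z)" by (simp add: inner_diff_right)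
    also have "x \<bullet> (y - z) \<le> norm x * norm (y - z)" by (rule norm_cauchy_schwarz)
    also have "norm x * norm (y - z) \<le> norm x * r" using z by (intro mult_left_mono) (auto simp: dist_norm)
    finally show "x \<bullet> y \<le> support_fun L x + r * norm x"
      using inner_le_support_fun[OF L z(1), of x] by (simp add: mult.commute)
  qed
  then show ?thesis by simp
qed

text \<open>The bound \<open>h_L + r * norm\<close> is the support function of the parallel body of
  \<open>L\<close> at distance \<open>r\<close>, so \<open>K\<close> is contained in that
  body.\<close>

lemma support_diff_imp_near:
  fixes K L :: "'a::euclidean_space set"
  assumes K: "K \<in> convex_bodies" and L: "L \<in> convex_bodies" and r: "r \<ge> 0"
    and le: "\<And>x. support_fun K x - support_fun L x \<le> r * norm x" and x: "x \<in> K"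
  shows "\<exists>y\<in>L. dist x y \<le> r"
proof -
  define P where "P = (\<Union>y\<in>L. \<Union>z\<in>cball 0 r. {y + z})"
  have "convex P" "compact P" using L
    unfolding P_def convex_bodies_def by (auto intro: convex_sums compact_sums')
  moreover have "0 \<in> cball (0::'a) r" using r by simp
  then have "P \<noteq> {}" using L unfolding P_def convex_bodies_def by blast
  ultimately have P: "P \<in> convex_bodies" by (simp add: convex_bodies_def)
  have ge: "support_fun L u + r * norm u \<le> support_fun P u" for u
  proof -
    \<comment> \<open>A point of the ball that is extreme in direction \<open>u\<close>. For
      \<open>u = 0\<close> division by zero gives \<open>z = 0\<close>, which also serves.\<close>
    define z where "z = (r / norm u) *\<^sub>R u"
    have z: "u \<bullet> z = r * norm u" "z \<in> cball 0 r"
      using r by (auto simp: z_def power2_norm_eq_inner[symmetric] power2_eq_square)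
    have "support_fun L u \<le> support_fun P u - r * norm u"
    proof (rule support_fun_le[OF L])
      fix y assume "y \<in> L"
      then have "y + z \<in> P" using z(2) unfolding P_def by blast
      from inner_le_support_fun[OF P this, of u] show "u \<bullet> y \<le> support_fun P u - r * norm u"
        using z by (simp add: inner_add_right)
    qed
    then show ?thesis by simp
  qed
  have "u \<bullet> x \<le> support_fun P u" for u
    using inner_le_support_fun[OF K x, of u] le[of u] ge[of u] by linarith
  then have "x \<in> P" using convex_body_eq_support[OF P] by blast
  then obtain y z where "y \<in> L" "z \<in> cball 0 r" "x = y + z" by (auto simp: P_def)
  then show ?thesis by (intro bexI[of _ y]) (simp_all add: dist_norm)
qed

text \<open>This is the uniform distance of the support functions on the unit sphere, homogenised by
  the factor \<open>norm x\<close>. Each of the two one-sided nearness conditions corresponds to one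
  sign of the difference.\<close>

lemma hausdorff_dist_le_iff_support:
  assumes K: "K \<in> convex_bodies" and L: "L \<in> convex_bodies" and r: "r \<ge> 0"
  shows "hausdorff_dist K L \<le> r \<longleftrightarrow> (\<forall>x. \<bar>support_fun K x - support_fun L x\<bar> \<le> r * norm x)"
proof
  assume "hausdorff_dist K L \<le> r"
  then show "\<forall>x. \<bar>support_fun K x - support_fun L x\<bar> \<le> r * norm x"
    using support_diff_le_of_near[OF K L, of r] support_diff_le_of_near[OF L K, of r]
    unfolding hausdorff_dist_le_iff[OF K L] by (auto simp: abs_le_iff)
next
  assume *: "\<forall>x. \<bar>support_fun K x - support_fun L x\<bar> \<le> r * norm x"
  have "support_fun K x - support_fun L x \<le> r * norm x" "support_fun L x - support_fun K x \<le> r * norm x" for x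
    using spec[OF *, of x] by (auto simp: abs_le_iff)
  then show "hausdorff_dist K L \<le> r"
    unfolding hausdorff_dist_le_iff[OF K L]
    using support_diff_imp_near[OF K L r] support_diff_imp_near[OF L K r] by blast
qed

lemma hausdorff_dist_nonneg:
  assumes K: "K \<in> convex_bodies" and L: "L \<in> convex_bodies"
  shows "hausdorff_dist K L \<ge> 0"
proof -
  obtain x where "x \<in> K" using K by (auto simp: convex_bodies_def)
  then obtain y where "dist x y \<le> hausdorff_dist K L" using hausdorff_dist_le_iff[OF K L] by blast
  then show ?thesis by (meson order_trans zero_le_dist)
qed

lemma abs_support_diff_le_hausdorff:
  assumes "K \<in> convex_bodies" "L \<in> convex_bodies"
  shows "\<bar>support_fun K x - support_fun L x\<bar> \<le> hausdorff_dist K L * norm x"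
  using hausdorff_dist_le_iff_support[OF assms hausdorff_dist_nonneg[OF assms]] by blast

text \<open>Pointwise convergence is what yields uniqueness of Hausdorff limits: two limits of one
  sequence have equal support functions.\<close>

lemma hausdorff_tendsto_support:
  assumes X: "\<And>m. X m \<in> convex_bodies" and K: "K \<in> convex_bodies" and lim: "hausdorff_tendsto X K"
  shows "(\<lambda>m. support_fun (X m) x) \<longlonglongrightarrow> support_fun K x"
proof (rule LIM_zero_cancel, rule Lim_null_comparison)
  show "\<forall>\<^sub>F m in sequentially. norm (support_fun (X m) x - support_fun K x) \<le> hausdorff_dist (X m) K * norm x"
    using abs_support_diff_le_hausdorff[OF X K] by simp
  show "(\<lambda>m. hausdorff_dist (X m) K * norm x) \<longlonglongrightarrow> 0"
    using lim by (auto simp: hausdorff_tendsto_def intro: tendsto_mult_left_zero)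
qed

section \<open>Linear images, symmetry and segments\<close>

lemma linear_image_convex_bodies:
  fixes f :: "'a::euclidean_space \<Rightarrow> 'b::euclidean_space"
  assumes "linear f" "K \<in> convex_bodies" shows "f ` K \<in> convex_bodies"
  using assms by (auto simp: convex_bodies_def linear_conv_bounded_linear
      intro!: convex_linear_image compact_continuous_image linear_continuous_on)

lemma linear_image_sym_convex_bodies:
  fixes f :: "'a::euclidean_space \<Rightarrow> 'b::euclidean_space"
  assumes f: "linear f" and K: "K \<in> sym_convex_bodies" shows "f ` K \<in> sym_convex_bodies"
proof -
  have "uminus ` f ` K = f ` uminus ` K" by (simp add: image_image linear_neg[OF f])
  then show ?thesis using K linear_image_convex_bodies[OF f, of K] by (simp add: sym_convex_bodies_def)
qed

lemma support_fun_linear_image: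
  fixes f :: "'a::euclidean_space \<Rightarrow> 'b::euclidean_space"
  assumes "linear f" shows "support_fun (f ` K) x = support_fun K (adjoint f x)"
  using adjoint_works[OF assms] by (simp add: support_fun_def image_image inner_commute)

lemma support_fun_minus_image: "support_fun (uminus ` K) x = support_fun K (- x)"
  by (simp add: support_fun_def image_image)

text \<open>The reflected body has support function \<open>h_K (- x)\<close>, so symmetry is
  evenness. In this form symmetry can be read off a formula for the support function.\<close>

lemma sym_convex_bodies_iff_support:
  "K \<in> sym_convex_bodies \<longleftrightarrow> K \<in> convex_bodies \<and> (\<forall>x. support_fun K (- x) = support_fun K x)"
proof -
  have "uminus ` K \<in> convex_bodies" if "K \<in> convex_bodies"
    using linear_image_convex_bodies[OF _ that, of uminus] by (simp add: linear_uminus)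
  then show ?thesis
    using support_fun_inject[of "uminus ` K" K] by (metis (mono_tags, lifting) mem_Collect_eq support_fun_minus_image sym_convex_bodies_def)
qed

lemma sym_support_scaleR:
  assumes K: "K \<in> sym_convex_bodies" shows "support_fun K (c *\<^sub>R x) = \<bar>c\<bar> * support_fun K x"
proof -
  have KC: "K \<in> convex_bodies" using K by (simp add: sym_convex_bodies_def)
  consider "c = 0" | "c > 0" | "c < 0" by linarith
  then show ?thesis
  proof cases
    case 3
    have "support_fun K (c *\<^sub>R x) = support_fun K (- (c *\<^sub>R x))" using K sym_convex_bodies_iff_support by metis
    also have "\<dots> = - c * support_fun K x" using support_fun_scaleR[OF KC, of "- c" x] 3 by simp
    finally show ?thesis using 3 by simp
  qed (simp_all add: support_fun_zero[OF KC] support_fun_scaleR[OF KC])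
qed

lemma symmetric_segment:
  fixes u :: "'a::euclidean_space"
  shows "closed_segment (- u) u \<in> sym_convex_bodies"
    and "support_fun (closed_segment (- u) u) x = \<bar>x \<bullet> u\<bar>"
proof -
  have C: "closed_segment (- u) u \<in> convex_bodies" by (simp add: convex_bodies_def)
  show S: "support_fun (closed_segment (- u) u) x = \<bar>x \<bullet> u\<bar>" for x
  proof (rule antisym)
    show "support_fun (closed_segment (- u) u) x \<le> \<bar>x \<bullet> u\<bar>"
    proof (rule support_fun_le[OF C])
      fix y assume "y \<in> closed_segment (- u) u"
      then obtain t where t: "0 \<le> t" "t \<le> 1" "y = (1 - t) *\<^sub>R (- u) + t *\<^sub>R u" by (auto simp: closed_segment_def)
      then have y: "x \<bullet> y = (2 * t - 1) * (x \<bullet> u)"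
        by (simp only: inner_add_right inner_minus_right inner_scaleR_right) (simp add: algebra_simps)
      have "x \<bullet> y \<le> \<bar>2 * t - 1\<bar> * \<bar>x \<bullet> u\<bar>" unfolding y by (metis abs_ge_self abs_mult)
      also have "\<dots> \<le> 1 * \<bar>x \<bullet> u\<bar>" using t by (intro mult_right_mono) auto
      finally show "x \<bullet> y \<le> \<bar>x \<bullet> u\<bar>" by simp
    qed
    show "\<bar>x \<bullet> u\<bar> \<le> support_fun (closed_segment (- u) u) x"
      using inner_le_support_fun[OF C, of u x] inner_le_support_fun[OF C, of "- u" x] by auto
  qed
  show "closed_segment (- u) u \<in> sym_convex_bodies"
    using C by (simp add: sym_convex_bodies_iff_support S)
qed

section \<open>Covariance under rank one maps\<close>

lemma GL_covariant_op_linear: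
  fixes f :: "real^'n \<Rightarrow> real^'n"
  assumes "GL_covariant_op star" "linear f" "inj f" "K \<in> sym_convex_bodies" "L \<in> sym_convex_bodies"
  shows "f ` star K L = star (f ` K) (f ` L)"
proof -
  have f: "(*v) (matrix f) = f" using matrix_works assms(2) by (auto simp: fun_eq_iff)
  have "invertible (matrix f)"
    using assms(3) f matrix_left_invertible_injective[of "matrix f"] by (simp add: invertible_left_inverse)
  then show ?thesis using assms(1,4,5) f unfolding GL_covariant_op_def by metis
qed

text \<open>Pairing the image of \<open>y\<close> with \<open>x\<close> gives
  \<open>(t + x \<bullet> e) * (x \<bullet> y)\<close>. On the kernel this forces
  \<open>x \<bullet> y = 0\<close>, after which only \<open>t *\<^sub>R y\<close> remains.\<close>

lemma rank_one_perturbation_inj: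
  fixes x e :: "'a::euclidean_space"
  assumes "t \<noteq> 0" "t + x \<bullet> e \<noteq> 0" shows "inj (\<lambda>y. t *\<^sub>R y + (x \<bullet> y) *\<^sub>R e)"
proof -
  have lin: "linear (\<lambda>y. t *\<^sub>R y + (x \<bullet> y) *\<^sub>R e)"
    by (rule linearI) (simp_all add: algebra_simps inner_add_right)
  have "y = 0" if y: "t *\<^sub>R y + (x \<bullet> y) *\<^sub>R e = 0" for y
  proof -
    have "x \<bullet> (t *\<^sub>R y + (x \<bullet> y) *\<^sub>R e) = (t + x \<bullet> e) * (x \<bullet> y)" by (simp add: inner_add_right algebra_simps)
    then have "x \<bullet> y = 0" using y assms by simp
    then show ?thesis using y assms by simp
  qed
  then show ?thesis using linear_injective_0[OF lin] by blast
qed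

text \<open>Match the two images of the same \<open>y\<close>: they are at distance at most
  \<open>\<bar>t m\<bar> * R\<close>, where \<open>R\<close> bounds the norm on
  \<open>K\<close>.\<close>

lemma linear_perturbation_tendsto:
  fixes f :: "'a::euclidean_space \<Rightarrow> 'a"
  assumes f: "linear f" and K: "K \<in> convex_bodies" and t: "t \<longlonglongrightarrow> (0::real)"
  shows "hausdorff_tendsto (\<lambda>m. (\<lambda>y. t m *\<^sub>R y + f y) ` K) (f ` K)"
proof -
  have "bounded K" using K by (simp add: convex_bodies_def compact_imp_bounded)
  then obtain R where R: "\<And>y. y \<in> K \<Longrightarrow> norm y \<le> R" unfolding bounded_iff by blast
  have lin: "linear (\<lambda>y. c *\<^sub>R y + f y)" for c
    using f by (intro linear_compose_add linear_scale_self) auto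
  have le: "hausdorff_dist ((\<lambda>y. t m *\<^sub>R y + f y) ` K) (f ` K) \<le> \<bar>t m\<bar> * R" for m
  proof -
    have "dist (t m *\<^sub>R y + f y) (f y) \<le> \<bar>t m\<bar> * R" "dist (f y) (t m *\<^sub>R y + f y) \<le> \<bar>t m\<bar> * R"
      if "y \<in> K" for y using R[OF that] by (simp_all add: dist_norm mult_left_mono)
    then show ?thesis
      unfolding hausdorff_dist_le_iff[OF linear_image_convex_bodies[OF lin K] linear_image_convex_bodies[OF f K]]
      by blast
  qed
  show ?thesis
    unfolding hausdorff_tendsto_def
  proof (rule Lim_null_comparison)
    show "\<forall>\<^sub>F m in sequentially. norm (hausdorff_dist ((\<lambda>y. t m *\<^sub>R y + f y) ` K) (f ` K)) \<le> \<bar>t m\<bar> * R"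
      using le hausdorff_dist_nonneg[OF linear_image_convex_bodies[OF lin K] linear_image_convex_bodies[OF f K]]
      by simp
    show "(\<lambda>m. \<bar>t m\<bar> * R) \<longlonglongrightarrow> 0" using t by (intro tendsto_mult_left_zero tendsto_rabs_zero)
  qed
qed

lemma rank_one_covariant:
  fixes star :: "(real^'n) set \<Rightarrow> (real^'n) set \<Rightarrow> (real^'n) set"
  assumes body: "\<And>K L. K \<in> sym_convex_bodies \<Longrightarrow> L \<in> sym_convex_bodies \<Longrightarrow> star K L \<in> convex_bodies"
    and cont: "hausdorff_continuous_op star" and GL: "GL_covariant_op star"
    and K: "K \<in> sym_convex_bodies" and L: "L \<in> sym_convex_bodies"
  shows "(\<lambda>y. (x \<bullet> y) *\<^sub>R e) ` star K L = star ((\<lambda>y. (x \<bullet> y) *\<^sub>R e) ` K) ((\<lambda>y. (x \<bullet> y) *\<^sub>R e) ` L)"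
proof -
  text \<open>With the sign chosen as that of \<open>x \<bullet> e\<close>, no \<open>t m + x \<bullet> e\<close> vanishes, so the
    perturbations of the rank one map are invertible.\<close>
  define t where "t = (\<lambda>m. (if x \<bullet> e \<ge> 0 then 1 else -1) * inverse (real (Suc m)))"
  define f where "f = (\<lambda>y. (x \<bullet> y) *\<^sub>R e)"
  define g where "g = (\<lambda>m y. t m *\<^sub>R y + f y)"
  have f: "linear f" by (rule linearI) (simp_all add: f_def algebra_simps inner_add_right)
  have g: "linear (g m)" for m
    unfolding g_def using f by (intro linear_compose_add linear_scale_self) auto
  have t0: "t \<longlonglongrightarrow> 0" unfolding t_def using tendsto_mult_right_zero[OF LIMSEQ_inverse_real_of_nat] by simp
  have "inj (g m)" for m
  proof -
    have "t m \<noteq> 0" "t m + x \<bullet> e \<noteq> 0"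
      using positive_imp_inverse_positive[of "real (Suc m)"]
      by (auto simp: t_def simp del: inverse_positive_iff_positive of_nat_Suc)
    then show ?thesis unfolding g_def f_def by (rule rank_one_perturbation_inj)
  qed
  note cov = GL_covariant_op_linear[OF GL g this K L]
  note KC = K[unfolded sym_convex_bodies_def, simplified, THEN conjunct1]
    and LC = L[unfolded sym_convex_bodies_def, simplified, THEN conjunct1]
  have lim: "hausdorff_tendsto (\<lambda>m. g m ` M) (f ` M)" if "M \<in> convex_bodies" for M
    unfolding g_def by (rule linear_perturbation_tendsto[OF f that t0])
  note gs = linear_image_sym_convex_bodies[OF g] and fs = linear_image_sym_convex_bodies[OF f]
  have 1: "hausdorff_tendsto (\<lambda>m. g m ` star K L) (f ` star K L)" by (rule lim[OF body[OF K L]])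
  have "hausdorff_tendsto (\<lambda>m. star (g m ` K) (g m ` L)) (star (f ` K) (f ` L))"
  proof -
    have "range (\<lambda>m. g m ` K) \<subseteq> sym_convex_bodies" "range (\<lambda>m. g m ` L) \<subseteq> sym_convex_bodies"
      using gs[OF K] gs[OF L] by blast+
    then show ?thesis
      using cont fs[OF K] fs[OF L] lim[OF KC] lim[OF LC] unfolding hausdorff_continuous_op_def by blast
  qed
  then have 2: "hausdorff_tendsto (\<lambda>m. g m ` star K L) (star (f ` K) (f ` L))" by (simp add: cov)
  have B: "f ` star K L \<in> convex_bodies" "star (f ` K) (f ` L) \<in> convex_bodies" "g m ` star K L \<in> convex_bodies" for m
    using body[OF fs[OF K] fs[OF L]] linear_image_convex_bodies[OF f body[OF K L]] linear_image_convex_bodies[OF g body[OF K L]]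
    by auto
  \<comment> \<open>By covariance under the invertible \<open>g m\<close>, facts \<open>1\<close>
    and \<open>2\<close> give two limits of one and the same sequence.\<close>
  have "f ` star K L = star (f ` K) (f ` L)"
    using B by (intro support_fun_inject)
      (auto intro!: LIMSEQ_unique[OF hausdorff_tendsto_support[OF _ _ 1] hausdorff_tendsto_support[OF _ _ 2]])
  then show ?thesis by (simp add: f_def)
qed

lemma rank_one_image:
  fixes x e :: "'a::euclidean_space"
  assumes K: "K \<in> sym_convex_bodies"
  shows "(\<lambda>y. (x \<bullet> y) *\<^sub>R e) ` K = closed_segment (- (support_fun K x *\<^sub>R e)) (support_fun K x *\<^sub>R e)"
proof (rule support_fun_inject)
  have f: "linear (\<lambda>y. (x \<bullet> y) *\<^sub>R e)" by (rule linearI) (simp_all add: scaleR_add_left inner_add_right)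
  show "(\<lambda>y. (x \<bullet> y) *\<^sub>R e) ` K \<in> convex_bodies"
    using linear_image_sym_convex_bodies[OF f K] by (simp add: sym_convex_bodies_def)
  show "closed_segment (- (support_fun K x *\<^sub>R e)) (support_fun K x *\<^sub>R e) \<in> convex_bodies"
    by (simp add: convex_bodies_def)
  fix z
  have "support_fun ((\<lambda>y. (x \<bullet> y) *\<^sub>R e) ` K) z = support_fun K ((z \<bullet> e) *\<^sub>R x)"
    by (simp add: support_fun_def image_image mult.commute)
  also have "\<dots> = \<bar>z \<bullet> (support_fun K x *\<^sub>R e)\<bar>"
    using sym_support_nonneg[OF K, of x] by (simp add: sym_support_scaleR[OF K] abs_mult)
  finally show "support_fun ((\<lambda>y. (x \<bullet> y) *\<^sub>R e) ` K) z
      = support_fun (closed_segment (- (support_fun K x *\<^sub>R e)) (support_fun K x *\<^sub>R e)) z"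
    by (simp only: symmetric_segment(2))
qed

section \<open>Representation by a function on the quadrant\<close>

lemma seminorm_semigroup_representation:
  fixes star :: "(real^'n) set \<Rightarrow> (real^'n) set \<Rightarrow> (real^'n) set"
  assumes n: "CARD('n) \<ge> 2"
    and body: "\<And>K L. K \<in> sym_convex_bodies \<Longrightarrow> L \<in> sym_convex_bodies \<Longrightarrow> star K L \<in> convex_bodies"
    and cont: "hausdorff_continuous_op star" and GL: "GL_covariant_op star"
    and assoc: "associative_op star"
  obtains F where "seminorm_semigroup F"
    "\<And>K L x. K \<in> sym_convex_bodies \<Longrightarrow> L \<in> sym_convex_bodies \<Longrightarrow>
       support_fun (star K L) x = F (support_fun K x) (support_fun L x)"
proof -
  obtain i j :: 'n where ij: "i \<noteq> j"
    using n card_le_Suc0_iff_eq[of "UNIV :: 'n set"] by (metis finite not_less_eq_eq numeral_2_eq_2)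
  define e where "e = (axis i 1 :: real^'n)"
  define I where "I = (\<lambda>a. closed_segment (- (a *\<^sub>R e)) (a *\<^sub>R e))"
  \<comment> \<open>\<open>I a\<close> has support value \<open>a\<close> at \<open>e\<close>, so
    the desired formula, applied to these segments at \<open>e\<close>, leaves no other choice of
    \<open>F\<close>.\<close>
  define F where "F = (\<lambda>a b. support_fun (star (I a) (I b)) e)"
  have ee: "e \<bullet> e = 1" by (simp add: e_def inner_axis_axis)
  have I: "I a \<in> sym_convex_bodies" for a unfolding I_def by (rule symmetric_segment)
  have hI: "support_fun (I a) e = a" if "a \<ge> 0" for a
    using that by (simp add: I_def symmetric_segment ee)
  have rep: "support_fun (star K L) x = F (support_fun K x) (support_fun L x)"
    if K: "K \<in> sym_convex_bodies" and L: "L \<in> sym_convex_bodies" for K L x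
  proof -
    have "F (support_fun K x) (support_fun L x) = support_fun ((\<lambda>y. (x \<bullet> y) *\<^sub>R e) ` star K L) e"
      using rank_one_covariant[OF body cont GL K L, of x e]
      by (simp add: F_def I_def rank_one_image K L)
    also have "\<dots> = support_fun (star K L) x" by (simp add: support_fun_def image_image ee)
    finally show ?thesis by simp
  qed
  \<comment> \<open>By \<open>rep\<close> the support function inherits evenness from those of
    \<open>K\<close> and \<open>L\<close>. This makes \<open>rep\<close> applicable to iterated
    products.\<close>
  have sym: "star K L \<in> sym_convex_bodies" if K: "K \<in> sym_convex_bodies" and L: "L \<in> sym_convex_bodies" for K L
    unfolding sym_convex_bodies_iff_support
    using body[OF K L] rep[OF K L] K L by (simp add: sym_convex_bodies_iff_support)
  have nonneg: "F a b \<ge> 0" for a b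
    unfolding F_def by (intro sym_support_nonneg sym I)
  have "seminorm_semigroup F"
  proof
    fix a b :: real show "F a b \<ge> 0" by (rule nonneg)
  next
    fix a b c :: real assume "c \<ge> 0" "a \<ge> 0" "b \<ge> 0"
    \<comment> \<open>Evaluate the product of \<open>I a\<close> and \<open>I b\<close> at
      \<open>c *\<^sub>R e\<close>, once by \<open>rep\<close> and once by homogeneity of its
      support function.\<close>
    then show "F (c * a) (c * b) = c * F a b"
      using rep[OF I I, of a b "c *\<^sub>R e"] sym_support_scaleR[OF sym[OF I I], of a b c e]
      by (simp add: sym_support_scaleR[OF I] hI F_def)
  next
    fix a a' b b' :: real
    \<comment> \<open>The second axis is where the dimension enters. On the plane of
      \<open>e\<close> and \<open>u\<close> the two segments have support functions
      \<open>\<bar>c\<bar>\<close> and \<open>\<bar>d\<bar>\<close>, so \<open>triangle\<close>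
      becomes subadditivity of one support function.\<close>
    define u where "u = (axis j 1 :: real^'n)"
    have eu: "e \<bullet> u = 0" "u \<bullet> e = 0" "u \<bullet> u = 1" using ij by (auto simp: e_def u_def inner_axis_axis)
    let ?K = "closed_segment (- e) e" and ?L = "closed_segment (- u) u"
    note S = symmetric_segment(1)[of e] symmetric_segment(1)[of u]
    have G: "support_fun (star ?K ?L) (c *\<^sub>R e + d *\<^sub>R u) = F \<bar>c\<bar> \<bar>d\<bar>" for c d
      by (simp add: rep[OF S] symmetric_segment(2) inner_add_left ee eu)
    show "F \<bar>a + a'\<bar> \<bar>b + b'\<bar> \<le> F \<bar>a\<bar> \<bar>b\<bar> + F \<bar>a'\<bar> \<bar>b'\<bar>"
      using support_fun_add_le[OF body[OF S], of "a *\<^sub>R e + b *\<^sub>R u" "a' *\<^sub>R e + b' *\<^sub>R u"]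
        G[of "a + a'" "b + b'"] by (simp add: G algebra_simps)
  next
    fix a b c :: real assume "a \<ge> 0" "b \<ge> 0" "c \<ge> 0"
    moreover have "star (I a) (star (I b) (I c)) = star (star (I a) (I b)) (I c)"
      using assoc I unfolding associative_op_def by blast
    then have "support_fun (star (I a) (star (I b) (I c))) e = support_fun (star (star (I a) (I b)) (I c)) e" by simp
    ultimately show "F a (F b c) = F (F a b) c"
      by (simp add: rep I sym hI)
  qed
  with rep show ?thesis using that by blast
qed

section \<open>Properties of \<open>L_p\<close> addition\<close>

text \<open>For \<open>p\<close> at least 1 this is the \<open>l_p\<close> norm on the quadrant.
  Taking the root here gives an equation for the support function itself instead of its
  power.\<close>

definition lp2 :: "ereal \<Rightarrow> real \<Rightarrow> real \<Rightarrow> real" where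
  "lp2 p a b = (if p = \<infinity> then max a b
     else (a powr real_of_ereal p + b powr real_of_ereal p) powr (1 / real_of_ereal p))"

lemma is_Lp_sum_iff_lp2:
  assumes p: "1 \<le> p" and K: "K \<in> sym_convex_bodies" and L: "L \<in> sym_convex_bodies"
  shows "is_Lp_sum p K L M \<longleftrightarrow>
    M \<in> convex_bodies \<and> (\<forall>x. support_fun M x = lp2 p (support_fun K x) (support_fun L x))"
proof (cases "p = \<infinity>")
  case False
  define q where "q = real_of_ereal p"
  have q: "q \<ge> 1" using p False by (cases p) (auto simp: q_def)
  have "u \<ge> 0 \<and> u powr q = a powr q + b powr q \<longleftrightarrow> u = lp2 p a b" for a b u
  proof
    assume u: "u \<ge> 0 \<and> u powr q = a powr q + b powr q"
    then have "u = (u powr q) powr (1 / q)" using q unfolding powr_powr by simp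
    then show "u = lp2 p a b" using u False by (simp add: lp2_def q_def)
  next
    assume "u = lp2 p a b"
    then show "u \<ge> 0 \<and> u powr q = a powr q + b powr q"
      using q False by (simp add: lp2_def powr_powr flip: q_def)
  qed
  then show ?thesis using False by (simp add: is_Lp_sum_def q_def)
qed (simp add: is_Lp_sum_def lp2_def)

lemma lp2_mono:
  assumes "1 \<le> p" "0 \<le> a" "a \<le> a'" "0 \<le> b" "b \<le> b'" shows "lp2 p a b \<le> lp2 p a' b'"
proof (cases "p = \<infinity>")
  case False
  then have "real_of_ereal p \<ge> 1" using assms(1) by (cases p) auto
  then show ?thesis using assms False by (auto simp: lp2_def intro!: powr_mono2 add_mono)
qed (use assms in \<open>auto simp: lp2_def\<close>)

lemma lp2_add_le:
  assumes "1 \<le> p" "0 \<le> a" "0 \<le> b" "0 \<le> c" "0 \<le> d"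
  shows "lp2 p (a + c) (b + d) \<le> lp2 p a b + lp2 p c d"
proof (cases "p = \<infinity>")
  case False
  then have "real_of_ereal p \<ge> 1" using assms(1) by (cases p) auto
  then show ?thesis using assms False minkowski2 by (auto simp: lp2_def)
qed (auto simp: lp2_def)

lemma lp2_axes:
  assumes "1 \<le> p" "0 \<le> a" shows "lp2 p a 0 = a" "lp2 p 0 a = a"
proof -
  have "lp2 p a 0 = a \<and> lp2 p 0 a = a"
  proof (cases "p = \<infinity>")
    case False
    then have "real_of_ereal p \<ge> 1" using assms(1) by (cases p) auto
    then show ?thesis using assms False by (auto simp: lp2_def powr_powr)
  qed (use assms in \<open>auto simp: lp2_def\<close>)
  then show "lp2 p a 0 = a" "lp2 p 0 a = a" by auto
qed

lemma lp2_assoc: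
  assumes "1 \<le> p" "0 \<le> a" "0 \<le> b" "0 \<le> c" shows "lp2 p a (lp2 p b c) = lp2 p (lp2 p a b) c"
proof (cases "p = \<infinity>")
  case False
  then have "real_of_ereal p \<ge> 1" using assms(1) by (cases p) auto
  then show ?thesis using assms False by (auto simp: lp2_def powr_powr add.assoc)
qed (auto simp: lp2_def)

text \<open>Monotonicity and the triangle inequality bound the difference by the norm of the
  difference vector, which splits along the axes. The resulting constant does not depend on
  \<open>p\<close>.\<close>

lemma lp2_diff_le:
  assumes p: "1 \<le> p" and nn: "0 \<le> a" "0 \<le> b" "0 \<le> a'" "0 \<le> b'"
  shows "lp2 p a b - lp2 p a' b' \<le> \<bar>a - a'\<bar> + \<bar>b - b'\<bar>"
proof -
  have "lp2 p a b \<le> lp2 p (a' + \<bar>a - a'\<bar>) (b' + \<bar>b - b'\<bar>)"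
    using assms by (intro lp2_mono) auto
  also have "\<dots> \<le> lp2 p a' b' + lp2 p \<bar>a - a'\<bar> \<bar>b - b'\<bar>"
    using assms by (intro lp2_add_le) auto
  also have "lp2 p \<bar>a - a'\<bar> \<bar>b - b'\<bar> \<le> lp2 p \<bar>a - a'\<bar> 0 + lp2 p 0 \<bar>b - b'\<bar>"
    using lp2_add_le[OF p, of "\<bar>a - a'\<bar>" 0 0 "\<bar>b - b'\<bar>"] by simp
  finally show ?thesis by (simp add: lp2_axes[OF p])
qed

lemma Lp_add_convex_bodies:
  assumes "1 \<le> p" "K \<in> sym_convex_bodies" "L \<in> sym_convex_bodies"
  shows "Lp_add p K L \<in> convex_bodies"
    and "support_fun (Lp_add p K L) x = lp2 p (support_fun K x) (support_fun L x)"
  using is_Lp_sum_Lp_add[OF assms] is_Lp_sum_iff_lp2[OF assms] by auto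

lemma Lp_add_sym_convex_bodies:
  assumes "1 \<le> p" "K \<in> sym_convex_bodies" "L \<in> sym_convex_bodies"
  shows "Lp_add p K L \<in> sym_convex_bodies"
  using assms Lp_add_convex_bodies[OF assms] by (simp add: sym_convex_bodies_iff_support)

lemma Lp_add_associative:
  assumes p: "1 \<le> p" shows "associative_op (Lp_add p)"
  unfolding associative_op_def
  by (intro ballI support_fun_inject Lp_add_convex_bodies Lp_add_sym_convex_bodies p)
    (simp_all add: Lp_add_convex_bodies Lp_add_sym_convex_bodies p lp2_assoc sym_support_nonneg)

lemma Lp_add_GL_covariant:
  assumes p: "1 \<le> p" shows "GL_covariant_op (Lp_add p)"
  unfolding GL_covariant_op_def
proof (intro allI impI ballI support_fun_inject)
  fix A :: "real^'n^'n" and K L :: "(real^'n) set" and x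
  assume K: "K \<in> sym_convex_bodies" and L: "L \<in> sym_convex_bodies"
  note A = matrix_vector_mul_linear[of A]
  note AK = linear_image_sym_convex_bodies[OF A K] linear_image_sym_convex_bodies[OF A L]
  show "(*v) A ` Lp_add p K L \<in> convex_bodies"
    by (intro linear_image_convex_bodies A Lp_add_convex_bodies p K L)
  show "Lp_add p ((*v) A ` K) ((*v) A ` L) \<in> convex_bodies"
    by (intro Lp_add_convex_bodies p AK)
  show "support_fun ((*v) A ` Lp_add p K L) x = support_fun (Lp_add p ((*v) A ` K) ((*v) A ` L)) x"
    by (simp add: Lp_add_convex_bodies p AK K L support_fun_linear_image[OF A])
qed

text \<open>The Lipschitz bound \<open>lp2_diff_le\<close>, used in both orders and in every
  direction \<open>x\<close>, translates into Hausdorff distances through support functions.\<close>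

lemma hausdorff_dist_Lp_add_le:
  assumes p: "1 \<le> p" and K: "K \<in> sym_convex_bodies" "K' \<in> sym_convex_bodies"
    and L: "L \<in> sym_convex_bodies" "L' \<in> sym_convex_bodies"
  shows "hausdorff_dist (Lp_add p K L) (Lp_add p K' L') \<le> hausdorff_dist K K' + hausdorff_dist L L'"
proof -
  have C: "K \<in> convex_bodies" "K' \<in> convex_bodies" "L \<in> convex_bodies" "L' \<in> convex_bodies"
    using K L by (auto simp: sym_convex_bodies_def)
  have "\<bar>support_fun (Lp_add p K L) x - support_fun (Lp_add p K' L') x\<bar>
      \<le> (hausdorff_dist K K' + hausdorff_dist L L') * norm x" for x
  proof -
    note nn = sym_support_nonneg[OF K(1)] sym_support_nonneg[OF K(2)] sym_support_nonneg[OF L(1)] sym_support_nonneg[OF L(2)]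
    have "\<bar>support_fun (Lp_add p K L) x - support_fun (Lp_add p K' L') x\<bar>
      \<le> \<bar>support_fun K x - support_fun K' x\<bar> + \<bar>support_fun L x - support_fun L' x\<bar>"
      using lp2_diff_le[OF p nn(1) nn(3) nn(2) nn(4), of x x x x] lp2_diff_le[OF p nn(2) nn(4) nn(1) nn(3), of x x x x]
      by (simp add: Lp_add_convex_bodies p K L abs_minus_commute)
    also have "\<dots> \<le> hausdorff_dist K K' * norm x + hausdorff_dist L L' * norm x"
      by (intro add_mono abs_support_diff_le_hausdorff C)
    finally show ?thesis by (simp add: distrib_right)
  qed
  then show ?thesis
    using hausdorff_dist_le_iff_support[of "Lp_add p K L" "Lp_add p K' L'" "hausdorff_dist K K' + hausdorff_dist L L'"]
    by (simp add: Lp_add_convex_bodies p K L C hausdorff_dist_nonneg)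
qed

lemma Lp_add_hausdorff_continuous:
  assumes p: "1 \<le> p" shows "hausdorff_continuous_op (Lp_add p)"
  unfolding hausdorff_continuous_op_def
proof (intro allI impI)
  fix X Y :: "nat \<Rightarrow> 'a set" and K L :: "'a set"
  assume X: "range X \<subseteq> sym_convex_bodies" and Y: "range Y \<subseteq> sym_convex_bodies"
    and K: "K \<in> sym_convex_bodies" and L: "L \<in> sym_convex_bodies"
    and lim: "hausdorff_tendsto X K" "hausdorff_tendsto Y L"
  have XY: "X m \<in> sym_convex_bodies" "Y m \<in> sym_convex_bodies" for m using X Y by auto
  show "hausdorff_tendsto (\<lambda>m. Lp_add p (X m) (Y m)) (Lp_add p K L)"
    unfolding hausdorff_tendsto_def
  proof (rule Lim_null_comparison)
    show "\<forall>\<^sub>F m in sequentially. norm (hausdorff_dist (Lp_add p (X m) (Y m)) (Lp_add p K L))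
        \<le> hausdorff_dist (X m) K + hausdorff_dist (Y m) L"
      using hausdorff_dist_Lp_add_le[OF p XY(1) K XY(2) L]
      by (intro always_eventually allI) (simp add: hausdorff_dist_nonneg Lp_add_convex_bodies p XY K L)
    show "(\<lambda>m. hausdorff_dist (X m) K + hausdorff_dist (Y m) L) \<longlonglongrightarrow> 0"
      using lim tendsto_add_zero unfolding hausdorff_tendsto_def by blast
  qed
qed

section \<open>The classification\<close>

text \<open>This transfers the properties from a model operation that agrees with
  \<open>star\<close> only on symmetric pairs. Associativity nests the operation, so the model must
  return symmetric bodies.\<close>

lemma op_properties_cong:
  fixes star star' :: "(real^'n) set \<Rightarrow> (real^'n) set \<Rightarrow> (real^'n) set"
  assumes eq: "\<And>K L. K \<in> sym_convex_bodies \<Longrightarrow> L \<in> sym_convex_bodies \<Longrightarrow> star K L = star' K L"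
    and sym: "\<And>K L. K \<in> sym_convex_bodies \<Longrightarrow> L \<in> sym_convex_bodies \<Longrightarrow> star' K L \<in> sym_convex_bodies"
    and props: "hausdorff_continuous_op star'" "GL_covariant_op star'" "associative_op star'"
  shows "hausdorff_continuous_op star \<and> GL_covariant_op star \<and> associative_op star"
proof (intro conjI)
  have "(*v) A ` K \<in> sym_convex_bodies" if "K \<in> sym_convex_bodies" for A :: "real^'n^'n" and K
    by (intro linear_image_sym_convex_bodies that matrix_vector_mul_linear)
  then show "GL_covariant_op star"
    using props(2) unfolding GL_covariant_op_def by (simp add: eq)
  show "associative_op star"
    using props(3) unfolding associative_op_def by (simp add: eq sym)
  show "hausdorff_continuous_op star"
    unfolding hausdorff_continuous_op_def
  proof (intro allI impI)
    fix X Y :: "nat \<Rightarrow> (real^'n) set" and K L :: "(real^'n) set"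
    assume X: "range X \<subseteq> sym_convex_bodies" and Y: "range Y \<subseteq> sym_convex_bodies"
      and KL: "K \<in> sym_convex_bodies" "L \<in> sym_convex_bodies"
      and lim: "hausdorff_tendsto X K" "hausdorff_tendsto Y L"
    have "star (X m) (Y m) = star' (X m) (Y m)" for m using X Y by (intro eq) auto
    moreover have "hausdorff_tendsto (\<lambda>m. star' (X m) (Y m)) (star' K L)"
      using props(1) X Y KL lim unfolding hausdorff_continuous_op_def by blast
    ultimately show "hausdorff_tendsto (\<lambda>m. star (X m) (Y m)) (star K L)"
      by (simp add: eq KL)
  qed
qed

theorem theoremA:
  fixes star :: "(real^'n) set \<Rightarrow> (real^'n) set \<Rightarrow> (real^'n) set"
  assumes "CARD('n) \<ge> 2"
    and "\<And>K L. K \<in> sym_convex_bodies \<Longrightarrow> L \<in> sym_convex_bodies \<Longrightarrow> star K L \<in> convex_bodies"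
  shows "(hausdorff_continuous_op star \<and> GL_covariant_op star \<and> associative_op star) \<longleftrightarrow>
      ((\<forall>K\<in>sym_convex_bodies. \<forall>L\<in>sym_convex_bodies. star K L = {0}) \<or>
       (\<forall>K\<in>sym_convex_bodies. \<forall>L\<in>sym_convex_bodies. star K L = K) \<or>
       (\<forall>K\<in>sym_convex_bodies. \<forall>L\<in>sym_convex_bodies. star K L = L) \<or>
       (\<exists>p::ereal. 1 \<le> p \<and>
          (\<forall>K\<in>sym_convex_bodies. \<forall>L\<in>sym_convex_bodies. star K L = Lp_add p K L)))"
proof
  assume H: "hausdorff_continuous_op star \<and> GL_covariant_op star \<and> associative_op star"
  obtain F where F: "seminorm_semigroup F"
    and rep: "\<And>K L x. K \<in> sym_convex_bodies \<Longrightarrow> L \<in> sym_convex_bodies \<Longrightarrow>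
       support_fun (star K L) x = F (support_fun K x) (support_fun L x)"
    using seminorm_semigroup_representation[OF assms H[THEN conjunct1]
        H[THEN conjunct2, THEN conjunct1] H[THEN conjunct2, THEN conjunct2]] by blast
  interpret seminorm_semigroup F by (rule F)
  have C: "K \<in> convex_bodies" if "K \<in> sym_convex_bodies" for K :: "(real^'n) set"
    using that by (simp add: sym_convex_bodies_def)
  have Lp: "\<exists>p::ereal. 1 \<le> p \<and> (\<forall>K\<in>sym_convex_bodies. \<forall>L\<in>sym_convex_bodies. star K L = Lp_add p K L)"
    if p: "1 \<le> p" and eq: "\<And>a b. a \<ge> 0 \<Longrightarrow> b \<ge> 0 \<Longrightarrow> F a b = lp2 p a b" for p
    using p by (intro exI[of _ p] conjI ballI support_fun_inject)
      (simp_all add: assms(2) Lp_add_convex_bodies rep eq sym_support_nonneg)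
  consider "F 1 0 = 0" "F 0 1 = 0" | "F 1 0 = 1" "F 0 1 = 0" | "F 1 0 = 0" "F 0 1 = 1"
    | "F 1 0 = 1" "F 0 1 = 1" using left_axis_cases right_axis_cases by blast
  then show "(\<forall>K\<in>sym_convex_bodies. \<forall>L\<in>sym_convex_bodies. star K L = {0}) \<or>
       (\<forall>K\<in>sym_convex_bodies. \<forall>L\<in>sym_convex_bodies. star K L = K) \<or>
       (\<forall>K\<in>sym_convex_bodies. \<forall>L\<in>sym_convex_bodies. star K L = L) \<or>
       (\<exists>p::ereal. 1 \<le> p \<and>
          (\<forall>K\<in>sym_convex_bodies. \<forall>L\<in>sym_convex_bodies. star K L = Lp_add p K L))"
  proof cases
    case 1
    have "star K L = {0}" if K: "K \<in> sym_convex_bodies" and L: "L \<in> sym_convex_bodies" for K L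
    proof (rule support_fun_inject[OF assms(2)[OF K L]])
      show "{0::real^'n} \<in> convex_bodies" by (simp add: convex_bodies_def)
      fix x
      show "support_fun (star K L) x = support_fun {0} x"
        \<comment> \<open>With both axis values \<open>0\<close>, \<open>le_axes\<close> bounds
          \<open>F\<close> above by \<open>0\<close>.\<close>
        using nonneg le_axes sym_support_nonneg[OF K, of x] sym_support_nonneg[OF L, of x] 1
        by (simp add: rep[OF K L]) (simp add: support_fun_def order_antisym)
    qed
    then show ?thesis by blast
  next
    case 2
    have "star K L = K" if K: "K \<in> sym_convex_bodies" and L: "L \<in> sym_convex_bodies" for K L
      by (rule support_fun_inject[OF assms(2)[OF K L] C[OF K]])
        (simp add: rep K L left_projection[OF 2] sym_support_nonneg)
    then show ?thesis by blast
  next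
    case 3
    have "star K L = L" if K: "K \<in> sym_convex_bodies" and L: "L \<in> sym_convex_bodies" for K L
      by (rule support_fun_inject[OF assms(2)[OF K L] C[OF L]])
        (simp add: rep K L right_projection[OF 3] sym_support_nonneg)
    then show ?thesis by blast
  next
    case 4
    show ?thesis
    \<comment> \<open>For \<open>L_p\<close> addition \<open>F 1 1\<close> is
      \<open>2 powr (1 / p)\<close>, so the value \<open>1\<close> marks the infinite
      exponent.\<close>
    proof (cases "F 1 1 = 1")
      case True
      then show ?thesis using Lp[of \<infinity>] eq_max[OF 4] by (simp add: lp2_def)
    next
      case False
      then obtain p where "p \<ge> 1" "\<And>a b. a \<ge> 0 \<Longrightarrow> b \<ge> 0 \<Longrightarrow> F a b = (a powr p + b powr p) powr (1 / p)"
        using eq_powr[OF 4] by blast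
      then show ?thesis using Lp[of "ereal p"] by (simp add: lp2_def)
    qed
  qed
next
  assume "(\<forall>K\<in>sym_convex_bodies. \<forall>L\<in>sym_convex_bodies. star K L = {0}) \<or>
       (\<forall>K\<in>sym_convex_bodies. \<forall>L\<in>sym_convex_bodies. star K L = K) \<or>
       (\<forall>K\<in>sym_convex_bodies. \<forall>L\<in>sym_convex_bodies. star K L = L) \<or>
       (\<exists>p::ereal. 1 \<le> p \<and>
          (\<forall>K\<in>sym_convex_bodies. \<forall>L\<in>sym_convex_bodies. star K L = Lp_add p K L))"
  then consider (zero) "\<forall>K\<in>sym_convex_bodies. \<forall>L\<in>sym_convex_bodies. star K L = {0}"
    | (left) "\<forall>K\<in>sym_convex_bodies. \<forall>L\<in>sym_convex_bodies. star K L = K"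
    | (right) "\<forall>K\<in>sym_convex_bodies. \<forall>L\<in>sym_convex_bodies. star K L = L"
    | (Lp) p :: ereal where "1 \<le> p"
        "\<forall>K\<in>sym_convex_bodies. \<forall>L\<in>sym_convex_bodies. star K L = Lp_add p K L"
    by blast
  then show "hausdorff_continuous_op star \<and> GL_covariant_op star \<and> associative_op star"
  proof cases
    case zero
    have "{0} \<in> sym_convex_bodies" by (simp add: sym_convex_bodies_def convex_bodies_def)
    with zero show ?thesis
      by (intro op_properties_cong[of star "\<lambda>_ _. {0}"])
        (auto simp: hausdorff_continuous_op_def GL_covariant_op_def associative_op_def
          hausdorff_tendsto_def hausdorff_dist_def)
  next
    case left
    then show ?thesis
      by (intro op_properties_cong[of star "\<lambda>K _. K"])
        (simp_all add: hausdorff_continuous_op_def GL_covariant_op_def associative_op_def)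
  next
    case right
    then show ?thesis
      by (intro op_properties_cong[of star "\<lambda>_ L. L"])
        (simp_all add: hausdorff_continuous_op_def GL_covariant_op_def associative_op_def)
  next
    case Lp
    then show ?thesis
      by (intro op_properties_cong[of star "Lp_add p"] Lp_add_sym_convex_bodies
          Lp_add_hausdorff_continuous Lp_add_GL_covariant Lp_add_associative) simp_all
  qed
qed

end
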